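(* For every integer $k\geq 2$, every $2k$-strong tournament is $k^{*}$-strongly connected.
   Context: A tournament is a digraph in which each pair of distinct vertices is joined by exactly one arc. A digraph is $m$-strong if it has more than $m$ vertices and remains strongly connected after deleting any set of fewer than $m$ vertices. For distinct vertices $u,v$ of a digraph $D$, a strong $k^{*}$-container between $u$ and $v$ is a set of $k$ internally disjoint paths that are either all $(u,v)$-paths or all $(v,u)$-paths, whose union contains every vertex of $D$. $D$ is $k^{*}$-strongly connected if there is a strong $k^{*}$-container between every two distinct vertices of $D$. *)

theory Defs
  imports Main
begin

definition digraph :: "'a set \<Rightarrow> ('a \<times> 'a) set \<Rightarrow> bool" where
  "digraph V A \<longleftrightarrow> finite V \<and> A \<subseteq> V \<times> V \<and> (\<forall>x. (x, x) \<notin> A)"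

definition tournament :: "'a set \<Rightarrow> ('a \<times> 'a) set \<Rightarrow> bool" where
  "tournament V A \<longleftrightarrow> digraph V A \<and>
     (\<forall>u\<in>V. \<forall>v\<in>V. u \<noteq> v \<longrightarrow> ((u, v) \<in> A \<longleftrightarrow> (v, u) \<notin> A))"

definition is_path :: "('a \<times> 'a) set \<Rightarrow> 'a list \<Rightarrow> 'a \<Rightarrow> 'a \<Rightarrow> bool" where
  "is_path A P u v \<longleftrightarrow> P \<noteq> [] \<and> hd P = u \<and> last P = v \<and> distinct P \<and>
     (\<forall>i. Suc i < length P \<longrightarrow> (P ! i, P ! Suc i) \<in> A)"

definition induced_arcs :: "('a \<times> 'a) set \<Rightarrow> 'a set \<Rightarrow> ('a \<times> 'a) set" where
  "induced_arcs A W = A \<inter> (W \<times> W)"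

definition strongly_connected :: "'a set \<Rightarrow> ('a \<times> 'a) set \<Rightarrow> bool" where
  "strongly_connected V A \<longleftrightarrow> V \<noteq> {} \<and>
     (\<forall>x\<in>V. \<forall>y\<in>V. \<exists>P. is_path (induced_arcs A V) P x y)"

definition m_strong :: "nat \<Rightarrow> 'a set \<Rightarrow> ('a \<times> 'a) set \<Rightarrow> bool" where
  "m_strong m V A \<longleftrightarrow> card V > m \<and>
     (\<forall>S. S \<subseteq> V \<and> card S < m \<longrightarrow> strongly_connected (V - S) (induced_arcs A (V - S)))"

definition internally_disjoint :: "'a list list \<Rightarrow> 'a \<Rightarrow> 'a \<Rightarrow> bool" where
  "internally_disjoint Ps u v \<longleftrightarrow> distinct Ps \<and>
     (\<forall>i<length Ps. \<forall>j<length Ps. i \<noteq> j \<longrightarrow> set (Ps ! i) \<inter> set (Ps ! j) \<subseteq> {u, v})"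

definition strong_container :: "nat \<Rightarrow> 'a set \<Rightarrow> ('a \<times> 'a) set \<Rightarrow> 'a \<Rightarrow> 'a \<Rightarrow> bool" where
  "strong_container k V A u v \<longleftrightarrow> (\<exists>Ps. length Ps = k \<and> internally_disjoint Ps u v \<and>
     ((\<forall>P\<in>set Ps. is_path A P u v) \<or> (\<forall>P\<in>set Ps. is_path A P v u)) \<and>
     (\<Union>P\<in>set Ps. set P) = V)"

definition k_star_strongly_connected :: "nat \<Rightarrow> 'a set \<Rightarrow> ('a \<times> 'a) set \<Rightarrow> bool" where
  "k_star_strongly_connected k V A \<longleftrightarrow>
     (\<forall>u\<in>V. \<forall>v\<in>V. u \<noteq> v \<longrightarrow> strong_container k V A u v)"

end

theory Submission
  imports Defs
begin

text \<open>
  By symmetry assume \<open>v \<rightarrow> u\<close>, so that every path from \<open>u\<close> to \<open>v\<close> has an interior; let \<open>S\<close> be the set of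
  out-neighbours of \<open>u\<close> and \<open>F\<close> the set of in-neighbours of \<open>v\<close>. Menger's theorem gives \<open>k + 2 \<le> 2k\<close>
  internally disjoint paths from \<open>u\<close> to \<open>v\<close>; choose \<open>k + 2\<close> such paths covering as many vertices as
  possible, and let \<open>R\<close> be the set of vertices left over. No chain of \<open>R\<close> can be inserted into one of the
  paths, and since \<open>T - u\<close> and \<open>T - v\<close> are strong this forces \<open>R\<close> to avoid \<open>S\<close> and \<open>F\<close>. Contracting
  the covered interior vertices to a single one leaves a strong semicomplete digraph, so \<open>R\<close> has a
  Hamiltonian path \<open>z\<close> that can be entered from, and left to, interiors of the paths. Because nothing can be
  inserted, it can even be entered from the end of some interior \<open>p\<close> and left to the beginning of some interior
  \<open>q\<close>. If \<open>p \<noteq> q\<close>, then \<open>p z q\<close> replaces \<open>p\<close> and \<open>q\<close>; otherwise \<open>z\<close> can be cut into \<open>z\<^sub>1 z\<^sub>2\<close>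
  such that \<open>Y z\<^sub>2 p z\<^sub>1 X\<close> is a chain for two further interiors \<open>X\<close>, \<open>Y\<close>. At least \<open>k\<close> paths remain
  and cover everything, and in a tournament two internally disjoint paths with common ends merge into one.
\<close>

subsection \<open>Menger's theorem\<close>

abbreviation chain :: "('a \<times> 'a) set \<Rightarrow> 'a list \<Rightarrow> bool" where
  "chain E \<equiv> successively (\<lambda>x y. (x, y) \<in> E)"

text \<open>Vertices may repeat, so that walks can be glued freely; \<open>walk_distinct\<close>
  restores distinctness afterwards. A single vertex of \<open>S \<inter> F\<close> counts as a
  walk.\<close>

definition walk :: "('a \<times> 'a) set \<Rightarrow> 'a set \<Rightarrow> 'a set \<Rightarrow> 'a list \<Rightarrow> bool" where
  "walk E S F p \<longleftrightarrow> p \<noteq> [] \<and> chain E p \<and> hd p \<in> S \<and> last p \<in> F"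

definition separates :: "('a \<times> 'a) set \<Rightarrow> 'a set \<Rightarrow> 'a set \<Rightarrow> 'a set \<Rightarrow> bool" where
  "separates E S F X \<longleftrightarrow> (\<forall>p. walk E S F p \<longrightarrow> set p \<inter> X \<noteq> {})"

lemma walk_rev: "walk (E\<inverse>) F S (rev p) \<longleftrightarrow> walk E S F p"
  by (auto simp: walk_def hd_rev last_rev)

lemma chain_distinct:
  assumes "chain E p" "p \<noteq> []"
  obtains q where "chain E q" "q \<noteq> []" "distinct q" "set q \<subseteq> set p" "hd q = hd p" "last q = last p"
proof -
  have "\<exists>q. chain E q \<and> q \<noteq> [] \<and> distinct q \<and> set q \<subseteq> set p \<and> hd q = hd p \<and> last q = last p"
    using assms
  proof (induction "length p" arbitrary: p rule: less_induct)
    case less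
    show ?case
    proof (cases "distinct p")
      case True
      with less.prems show ?thesis by blast
    next
      case False
      then obtain xs y ys zs where p: "p = xs @ [y] @ ys @ [y] @ zs"
        using not_distinct_decomp by blast
      let ?p = "xs @ [y] @ zs"
      have "length ?p < length p" "chain E ?p" "?p \<noteq> []"
        using less.prems p by (auto simp: successively_append_iff successively_Cons)
      from less.hyps[OF this] obtain q where
        "chain E q" "q \<noteq> []" "distinct q" "set q \<subseteq> set ?p" "hd q = hd ?p" "last q = last ?p"
        by blast
      moreover have "set ?p \<subseteq> set p" "hd ?p = hd p" "last ?p = last p"
        using p by (auto simp: hd_append)
      ultimately show ?thesis by (intro exI[of _ q]) auto
    qed
  qed
  with that show thesis by blast
qed

lemma walk_distinct:
  assumes "walk E S F p"
  obtains q where "walk E S F q" "distinct q" "set q \<subseteq> set p"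
  using assms chain_distinct[of E p] unfolding walk_def by metis

text \<open>The arc \<open>(x, y)\<close> can be traversed only if \<open>x\<close> occurs before
  the last position and \<open>y\<close> after the first.\<close>

lemma chain_remove_arc:
  assumes "chain (insert (x, y) E) p" "x \<notin> set (butlast p) \<or> y \<notin> set (tl p)"
  shows "chain E p"
  using assms(2)
proof
  assume "x \<notin> set (butlast p)"
  with assms(1) show ?thesis
    by (induction p rule: induct_list012) auto
next
  assume "y \<notin> set (tl p)"
  with assms(1) show ?thesis
    by (induction p rule: induct_list012) auto
qed

text \<open>
  Goering's proof by induction on the number of arcs: if removing the arc \<open>(x, y)\<close> creates a
  separator \<open>X\<close> with fewer than \<open>k\<close> vertices, paths from \<open>S\<close> to \<open>X \<union> {x}\<close> and from \<open>X \<union> {y}\<close> to \<open>F\<close>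
  can only meet in \<open>X\<close> and are glued there and along \<open>(x, y)\<close>.
\<close>

theorem menger:
  assumes "finite E" "finite S" "\<And>X. finite X \<Longrightarrow> separates E S F X \<Longrightarrow> k \<le> card X"
  shows "\<exists>P. (\<forall>i<k. walk E S F (P i) \<and> distinct (P i)) \<and>
             (\<forall>i<k. \<forall>j<k. i \<noteq> j \<longrightarrow> set (P i) \<inter> set (P j) = {})"
  using assms
proof (induction E arbitrary: S F rule: finite_induct)
  case empty
  \<comment> \<open>Without arcs every walk is a single vertex.\<close>
  have "separates {} S F (S \<inter> F)"
    unfolding separates_def walk_def
  proof (intro allI impI)
    fix p assume p: "p \<noteq> [] \<and> chain {} p \<and> hd p \<in> S \<and> last p \<in> F"
    then obtain x where "p = [x]"
      by (cases p rule: remdups_adj.cases) auto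
    with p show "set p \<inter> (S \<inter> F) \<noteq> {}" by auto
  qed
  with empty.prems have "card {..<k} \<le> card (S \<inter> F)" by auto
  then obtain f where f: "f ` {..<k} \<subseteq> S \<inter> F" "inj_on f {..<k}"
    using card_le_inj[of "{..<k}" "S \<inter> F"] empty.prems(1) by auto
  show ?case
    using f by (intro exI[of _ "\<lambda>i. [f i]"]) (auto simp: walk_def inj_on_def)
next
  case (insert e E)
  obtain x y where e: "e = (x, y)" by (cases e)
  show ?case
  proof (cases "\<forall>X. finite X \<longrightarrow> separates E S F X \<longrightarrow> k \<le> card X")
    case True
    then obtain P where P: "\<forall>i<k. walk E S F (P i) \<and> distinct (P i)"
        "\<forall>i<k. \<forall>j<k. i \<noteq> j \<longrightarrow> set (P i) \<inter> set (P j) = {}"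
      using insert.IH[OF insert.prems(1)] by metis
    have "walk E S F p \<Longrightarrow> walk (insert e E) S F p" for p
      unfolding walk_def by (auto elim: successively_mono)
    with P show ?thesis by blast
  next
    case False
    then obtain X where X: "finite X" "separates E S F X" "card X < k"
      by force
    \<comment> \<open>A walk in the full digraph that avoids \<open>X\<close> must traverse the
      removed arc, hence contains both of its ends.\<close>
    have sep: "separates (insert e E) S F (insert z X)" if "z = x \<or> z = y" for z
      unfolding separates_def
    proof (intro allI impI)
      fix p assume p: "walk (insert e E) S F p"
      show "set p \<inter> insert z X \<noteq> {}"
      proof
        assume emp: "set p \<inter> insert z X = {}"
        then have "x \<notin> set (butlast p) \<or> y \<notin> set (tl p)"
          using that in_set_butlastD[of x p] list.set_sel(2)[of p y] by (cases p) auto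
        then have "chain E p"
          using p e chain_remove_arc[of x y E p] by (auto simp: walk_def)
        then have "walk E S F p" using p by (auto simp: walk_def)
        with X(2) emp show False by (auto simp: separates_def)
      qed
    qed
    \<comment> \<open>As \<open>card X < k\<close>, adding one vertex has to reach \<open>k\<close>
      exactly, so \<open>X\<close> has \<open>k - 1\<close> vertices.\<close>
    have card: "card (insert z X) = k" "z \<notin> X" if "z = x \<or> z = y" for z
      using insert.prems(2)[OF _ sep[OF that]] X by (auto simp: card_insert_if split: if_splits)
    have "\<exists>P. (\<forall>i<k. walk E S (insert x X) (P i) \<and> distinct (P i)) \<and>
              (\<forall>i<k. \<forall>j<k. i \<noteq> j \<longrightarrow> set (P i) \<inter> set (P j) = {})"
    proof (rule insert.IH[OF insert.prems(1)])
      fix Y assume Y: "finite Y" "separates E S (insert x X) Y"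
      have "separates (insert e E) S F Y"
        unfolding separates_def
      proof (intro allI impI)
        fix p assume p: "walk (insert e E) S F p"
        then have "\<exists>s\<in>set p. s \<in> insert x X"
          using sep[of x] by (auto simp: separates_def)
        \<comment> \<open>Cutting at the first vertex of \<open>insert x X\<close> leaves
          \<open>x\<close> at most at the end of the prefix, which therefore cannot traverse
          \<open>(x, y)\<close>.\<close>
        then obtain p1 s p2 where s: "p = p1 @ s # p2" "s \<in> insert x X" "\<forall>t\<in>set p1. t \<notin> insert x X"
          using split_list_first_prop[of p "\<lambda>t. t \<in> insert x X"] by blast
        have "chain (insert e E) (p1 @ [s])"
          using p s by (auto simp: walk_def successively_append_iff)
        then have "chain E (p1 @ [s])"
          using chain_remove_arc[of x y E "p1 @ [s]"] s(3) e by auto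
        then have "walk E S (insert x X) (p1 @ [s])"
          using p s by (auto simp: walk_def hd_append split: if_splits)
        with Y(2) have "set (p1 @ [s]) \<inter> Y \<noteq> {}" unfolding separates_def by blast
        with s(1) show "set p \<inter> Y \<noteq> {}" by auto
      qed
      with Y(1) insert.prems(2) show "k \<le> card Y" by blast
    qed
    then obtain P where P: "\<And>i. i < k \<Longrightarrow> walk E S (insert x X) (P i)" "\<And>i. i < k \<Longrightarrow> distinct (P i)"
        "\<And>i j. i < k \<Longrightarrow> j < k \<Longrightarrow> i \<noteq> j \<Longrightarrow> set (P i) \<inter> set (P j) = {}"
      by metis
    have "\<exists>Q. (\<forall>i<k. walk E (insert y X) F (Q i) \<and> distinct (Q i)) \<and>
              (\<forall>i<k. \<forall>j<k. i \<noteq> j \<longrightarrow> set (Q i) \<inter> set (Q j) = {})"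
    proof (rule insert.IH)
      show "finite (insert y X)" using X by simp
      fix Y assume Y: "finite Y" "separates E (insert y X) F Y"
      have "separates (insert e E) S F Y"
        unfolding separates_def
      proof (intro allI impI)
        fix p assume p: "walk (insert e E) S F p"
        then have "\<exists>s\<in>set p. s \<in> insert y X"
          using sep[of y] by (auto simp: separates_def)
        \<comment> \<open>Dually, cutting at the last vertex of \<open>insert y X\<close> leaves
          \<open>y\<close> at most at the start of the suffix.\<close>
        then obtain p1 s p2 where s: "p = p1 @ s # p2" "s \<in> insert y X" "\<forall>t\<in>set p2. t \<notin> insert y X"
          using split_list_last_prop[of p "\<lambda>t. t \<in> insert y X"] by blast
        have "chain (insert e E) (s # p2)"
          using p s by (auto simp: walk_def successively_append_iff)
        then have "chain E (s # p2)"
          using chain_remove_arc[of x y E "s # p2"] s(3) e by auto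
        then have "walk E (insert y X) F (s # p2)"
          using p s by (auto simp: walk_def)
        with Y(2) have "set (s # p2) \<inter> Y \<noteq> {}" unfolding separates_def by blast
        with s(1) show "set p \<inter> Y \<noteq> {}" by auto
      qed
      with Y(1) insert.prems(2) show "k \<le> card Y" by blast
    qed
    then obtain Q where Q: "\<And>i. i < k \<Longrightarrow> walk E (insert y X) F (Q i)" "\<And>i. i < k \<Longrightarrow> distinct (Q i)"
        "\<And>i j. i < k \<Longrightarrow> j < k \<Longrightarrow> i \<noteq> j \<Longrightarrow> set (Q i) \<inter> set (Q j) = {}"
      by metis
    have lastP: "last (P i) \<in> set (P i)" "last (P i) \<in> insert x X" "P i \<noteq> []" if "i < k" for i
      using P(1)[OF that] by (auto simp: walk_def)
    have hdQ: "hd (Q i) \<in> set (Q i)" "hd (Q i) \<in> insert y X" "Q i \<noteq> []" if "i < k" for i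
      using Q(1)[OF that] by (auto simp: walk_def)
    have inj: "inj_on (\<lambda>i. last (P i)) {..<k}" "inj_on (\<lambda>i. hd (Q i)) {..<k}"
      using P(3) Q(3) lastP(1) hdQ(1) by (auto simp: inj_on_def) (metis disjoint_iff)+
    \<comment> \<open>The ends of \<open>k\<close> disjoint paths exhaust a set of \<open>k\<close>
      vertices. Each of these vertices thus belongs to one path only, as its end.\<close>
    have surjP: "(\<lambda>i. last (P i)) ` {..<k} = insert x X"
      using lastP(2) X(1) card card_image[OF inj(1)] by (intro card_subset_eq) auto
    have surjQ: "(\<lambda>i. hd (Q i)) ` {..<k} = insert y X"
      using hdQ(2) X(1) card card_image[OF inj(2)] by (intro card_subset_eq) auto
    have Ponly: "s = last (P i)" if "i < k" "s \<in> set (P i)" "s \<in> insert x X" for i s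
    proof -
      obtain j where "j < k" "s = last (P j)" using surjP \<open>s \<in> insert x X\<close> by blast
      with that P(3)[of i j] lastP(1)[of j] show ?thesis by (metis disjoint_iff)
    qed
    have Qonly: "s = hd (Q i)" if "i < k" "s \<in> set (Q i)" "s \<in> insert y X" for i s
    proof -
      obtain j where "j < k" "s = hd (Q j)" using surjQ \<open>s \<in> insert y X\<close> by blast
      with that Q(3)[of i j] hdQ(1)[of j] show ?thesis by (metis disjoint_iff)
    qed
    \<comment> \<open>Following \<open>P i\<close> up to \<open>z\<close> and then
      \<open>Q j\<close> avoids the removed arc, so this walk meets \<open>X\<close>. Vertices of
      \<open>X\<close> occur only at the end of \<open>P i\<close> and the start of
      \<open>Q j\<close>, which forces the meeting point to be \<open>z\<close>.\<close>
    have meet: "z \<in> X \<and> z = last (P i) \<and> z = hd (Q j)"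
      if ij: "i < k" "j < k" "z \<in> set (P i)" "z \<in> set (Q j)" for i j z
    proof -
      obtain p1 p2 where p: "P i = p1 @ z # p2" using ij(3) by (meson split_list)
      obtain q1 q2 where q: "Q j = q1 @ z # q2" using ij(4) by (meson split_list)
      have "walk E S F (p1 @ z # q2)"
        using P(1)[OF ij(1)] Q(1)[OF ij(2)] p q
        by (auto simp: walk_def successively_append_iff hd_append split: if_splits)
      then obtain s where s: "s \<in> X" "s \<in> set (p1 @ z # q2)"
        using X(2) unfolding separates_def by blast
      have "s = z"
      proof (cases "s \<in> set p1")
        case True
        then have "s = last (P i)" using Ponly[OF ij(1), of s] s p by auto
        then have "s \<in> set (z # p2)" using p by (metis last_appendR last_in_set list.distinct(1))
        with True P(2)[OF ij(1)] p show ?thesis by auto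
      next
        case False
        show ?thesis
        proof (rule ccontr)
          assume "s \<noteq> z"
          with False s have sq: "s \<in> set q2" by auto
          then have "s = hd (Q j)" using Qonly[OF ij(2), of s] s q by auto
          then have "s \<in> set (q1 @ [z])" using q by (cases q1) auto
          with sq Q(2)[OF ij(2)] q show False by auto
        qed
      qed
      with s Ponly[of i z] Qonly[of j z] ij show ?thesis by auto
    qed
    have "\<forall>i<k. \<exists>j<k. hd (Q j) = (if last (P i) = x then y else last (P i))"
    proof (intro allI impI)
      fix i assume "i < k"
      then have "(if last (P i) = x then y else last (P i)) \<in> insert y X"
        using lastP(2)[of i] by auto
      then show "\<exists>j<k. hd (Q j) = (if last (P i) = x then y else last (P i))"
        unfolding surjQ[symmetric] by force
    qed
    \<comment> \<open>\<open>Q (\<sigma> i)\<close> starts where \<open>P i\<close> ends, except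
      that \<open>x\<close> is matched with \<open>y\<close>.\<close>
    then obtain \<sigma> where \<sigma>: "\<And>i. i < k \<Longrightarrow> \<sigma> i < k"
      "\<And>i. i < k \<Longrightarrow> hd (Q (\<sigma> i)) = (if last (P i) = x then y else last (P i))"
      by metis
    \<comment> \<open>The two pieces are joined by the arc \<open>(x, y)\<close> or share a vertex,
      whose second copy \<open>tl\<close> drops.\<close>
    define N where "N i = (if last (P i) = x then P i @ Q (\<sigma> i) else P i @ tl (Q (\<sigma> i)))" for i
    have subN: "set (N i) \<subseteq> set (P i) \<union> set (Q (\<sigma> i))" for i
      using list.set_sel(2)[of "Q (\<sigma> i)"] by (cases "Q (\<sigma> i)") (auto simp: N_def)
    have mono: "chain E p \<Longrightarrow> chain (insert e E) p" for p
      by (auto elim: successively_mono)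
    have walkN: "walk (insert e E) S F (N i)" if "i < k" for i
    proof (cases "last (P i) = x")
      case True
      then show ?thesis
        using P(1)[OF that] Q(1)[OF \<sigma>(1)[OF that]] \<sigma>(2)[OF that] e mono[of "P i"] mono[of "Q (\<sigma> i)"]
        by (auto simp: N_def walk_def successively_append_iff)
    next
      case False
      have "Q (\<sigma> i) \<noteq> []" using hdQ(3) \<sigma>(1) that by blast
      then obtain z q where q: "Q (\<sigma> i) = z # q"
        by (cases "Q (\<sigma> i)") auto
      then have "z = last (P i)" using \<sigma>(2)[OF that] False by auto
      with False show ?thesis
        using P(1)[OF that] Q(1)[OF \<sigma>(1)[OF that]] q mono[of "P i"] mono[of "Q (\<sigma> i)"]
        by (auto simp: N_def walk_def successively_append_iff successively_Cons last_append)
    qed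
    have disjN: "set (N i) \<inter> set (N j) = {}" if ij: "i < k" "j < k" "i \<noteq> j" for i j
    proof -
      have PQ: "set (P i) \<inter> set (Q (\<sigma> j)) = {}" if ij: "i < k" "j < k" "i \<noteq> j" for i j
      proof (rule ccontr)
        assume "set (P i) \<inter> set (Q (\<sigma> j)) \<noteq> {}"
        then obtain z where "z \<in> X" "z = last (P i)" "z = hd (Q (\<sigma> j))"
          using meet[OF ij(1) \<sigma>(1)[OF ij(2)]] by blast
        with \<sigma>(2)[OF ij(2)] card(2)[of y] have "last (P i) = last (P j)" by (auto split: if_splits)
        with inj(1) ij show False by (auto simp: inj_on_def)
      qed
      have "\<sigma> i \<noteq> \<sigma> j"
      proof
        assume "\<sigma> i = \<sigma> j"
        with \<sigma>(2)[of i] \<sigma>(2)[of j] ij lastP(2)[of i] lastP(2)[of j] card(2)[of y]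
        have "last (P i) = last (P j)" by (auto split: if_splits)
        with inj(1) ij show False by (auto simp: inj_on_def)
      qed
      then have "set (Q (\<sigma> i)) \<inter> set (Q (\<sigma> j)) = {}" using Q(3) \<sigma>(1) ij by auto
      with PQ[of i j] PQ[of j i] P(3)[of i j] ij subN[of i] subN[of j] show ?thesis by blast
    qed
    have "\<forall>i. \<exists>p. i < k \<longrightarrow> walk (insert e E) S F p \<and> distinct p \<and> set p \<subseteq> set (N i)"
      using walk_distinct[OF walkN] by metis
    then obtain M where M: "\<And>i. i < k \<Longrightarrow> walk (insert e E) S F (M i) \<and> distinct (M i) \<and> set (M i) \<subseteq> set (N i)"
      by metis
    then show ?thesis using disjN by (intro exI[of _ M]) blast
  qed
qed

subsection \<open>Linkages of maximal coverage\<close>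

text \<open>
  A member of a linkage is the interior of a path from \<open>u\<close> to \<open>v\<close>: the end vertices enter only through
  the neighbourhoods \<open>S\<close> and \<open>F\<close>.
\<close>

definition linkage :: "'a set \<Rightarrow> ('a \<times> 'a) set \<Rightarrow> 'a set \<Rightarrow> 'a set \<Rightarrow> 'a list set \<Rightarrow> bool" where
  "linkage W E S F \<L> \<longleftrightarrow> finite \<L> \<and> (\<forall>p\<in>\<L>. walk E S F p \<and> distinct p \<and> set p \<subseteq> W) \<and>
     (\<forall>p\<in>\<L>. \<forall>q\<in>\<L>. p \<noteq> q \<longrightarrow> set p \<inter> set q = {})"

abbreviation cover :: "'a list set \<Rightarrow> 'a set" where
  "cover \<L> \<equiv> \<Union> (set ` \<L>)"

text \<open>Only linkages with the same number of members compete, so replacing one member by a path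
  through additional uncovered vertices already contradicts maximality.\<close>

definition maximal_linkage :: "'a set \<Rightarrow> ('a \<times> 'a) set \<Rightarrow> 'a set \<Rightarrow> 'a set \<Rightarrow> 'a list set \<Rightarrow> bool" where
  "maximal_linkage W E S F \<L> \<longleftrightarrow> linkage W E S F \<L> \<and>
     (\<forall>\<L>'. linkage W E S F \<L>' \<longrightarrow> card \<L>' = card \<L> \<longrightarrow> \<not> cover \<L> \<subset> cover \<L>')"

definition semicomplete_on :: "'a set \<Rightarrow> ('a \<times> 'a) set \<Rightarrow> bool" where
  "semicomplete_on W E \<longleftrightarrow> (\<forall>x\<in>W. \<forall>y\<in>W. x \<noteq> y \<longrightarrow> (x, y) \<in> E \<or> (y, x) \<in> E)"

section \<open>Reversal, replacement and maximality\<close>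

lemma semicomplete_on_converse: "semicomplete_on W (E\<inverse>) \<longleftrightarrow> semicomplete_on W E"
  by (auto simp: semicomplete_on_def)

lemma linkage_converse: "linkage W (E\<inverse>) F S (rev ` \<L>) \<longleftrightarrow> linkage W E S F \<L>"
proof -
  have "finite (rev ` \<L>) \<longleftrightarrow> finite \<L>"
    by (intro finite_image_iff) (auto simp: inj_on_def)
  then show ?thesis by (auto simp: linkage_def walk_rev)
qed

text \<open>Reversing all arcs swaps \<open>S\<close> and \<open>F\<close>; every result on arcs
  into uncovered vertices thereby yields one on arcs out of them.\<close>

lemma maximal_linkage_converse:
  assumes "maximal_linkage W E S F \<L>"
  shows "maximal_linkage W (E\<inverse>) F S (rev ` \<L>)"
  unfolding maximal_linkage_def
proof (intro conjI allI impI)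
  show "linkage W (E\<inverse>) F S (rev ` \<L>)"
    using assms by (auto simp: maximal_linkage_def linkage_converse)
  fix \<M> assume "linkage W (E\<inverse>) F S \<M>" "card \<M> = card (rev ` \<L>)"
  moreover have card: "card (rev ` \<N>) = card \<N>" for \<N> :: "'a list set"
    by (intro card_image) (auto simp: inj_on_def)
  moreover have "\<M> = rev ` rev ` \<M>" by (simp add: image_image)
  ultimately have "linkage W E S F (rev ` \<M>)" "card (rev ` \<M>) = card \<L>"
    using linkage_converse[of W E F S "rev ` \<M>"] by auto
  then have "\<not> cover \<L> \<subset> cover (rev ` \<M>)"
    using assms unfolding maximal_linkage_def by blast
  then show "\<not> cover (rev ` \<L>) \<subset> cover \<M>"
    by (simp add: image_image)
qed

text \<open>The surgery behind all later constructions: the members in \<open>\<Q>\<close> are fused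
  with uncovered vertices \<open>Z\<close> into one path, which stays disjoint from the other
  members.\<close>

lemma linkage_replace:
  assumes L: "linkage W E S F \<L>" and QL: "\<Q> \<subseteq> \<L>"
    and p: "walk E S F p" "distinct p" "set p = cover \<Q> \<union> Z"
    and Z: "Z \<subseteq> W - cover \<L>"
  shows "linkage W E S F (insert p (\<L> - \<Q>))"
    and "card (insert p (\<L> - \<Q>)) = Suc (card \<L> - card \<Q>)"
    and "cover (insert p (\<L> - \<Q>)) = cover \<L> \<union> Z"
proof -
  have disj: "set p \<inter> set q = {}" if "q \<in> \<L> - \<Q>" for q
  proof -
    have "set r \<inter> set q = {}" if "r \<in> \<Q>" for r
    proof -
      have "r \<in> \<L>" "q \<in> \<L>" "r \<noteq> q" using QL that \<open>q \<in> \<L> - \<Q>\<close> by auto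
      then show ?thesis using L by (auto simp: linkage_def)
    qed
    moreover have "Z \<inter> set q = {}" using Z that by blast
    ultimately show ?thesis unfolding p(3) by blast
  qed
  have "p \<noteq> []" using p(1) by (auto simp: walk_def)
  then have notin: "p \<notin> \<L> - \<Q>" using disj by fastforce
  have fin: "finite \<L>" "finite \<Q>"
    using L QL by (auto simp: linkage_def intro: finite_subset)
  have "cover \<Q> \<subseteq> W" using L QL unfolding linkage_def by blast
  with Z have "set p \<subseteq> W" unfolding p(3) by blast
  with L p disj show "linkage W E S F (insert p (\<L> - \<Q>))"
    unfolding linkage_def by (simp add: Int_commute)
  show "card (insert p (\<L> - \<Q>)) = Suc (card \<L> - card \<Q>)"
    using notin fin QL by (simp add: card_Diff_subset)
  show "cover (insert p (\<L> - \<Q>)) = cover \<L> \<union> Z"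
    using QL p(3) by auto
qed

lemma maximal_linkage_exists:
  assumes "finite W" "linkage W E S F \<L>"
  obtains \<M> where "maximal_linkage W E S F \<M>" "card \<M> = card \<L>"
proof -
  let ?P = "\<lambda>\<M>. linkage W E S F \<M> \<and> card \<M> = card \<L>"
  have sub: "cover \<M> \<subseteq> W" if "?P \<M>" for \<M> using that by (auto simp: linkage_def)
  then have "card (cover \<M>) < Suc (card W)" if "?P \<M>" for \<M>
    using that assms(1) by (simp add: card_mono less_Suc_eq_le)
  then obtain \<M> where M: "?P \<M>" "\<And>\<N>. ?P \<N> \<Longrightarrow> card (cover \<N>) \<le> card (cover \<M>)"
    using ex_has_greatest_nat[of ?P \<L> "\<lambda>\<M>. card (cover \<M>)" "Suc (card W)"] assms(2) by blast
  have "maximal_linkage W E S F \<M>"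
    unfolding maximal_linkage_def
  proof (intro conjI allI impI notI)
    fix \<N> assume N: "linkage W E S F \<N>" "card \<N> = card \<M>" "cover \<M> \<subset> cover \<N>"
    then have "card (cover \<M>) < card (cover \<N>)"
      using sub[of \<N>] M(1) assms(1) psubset_card_mono finite_subset by metis
    with M N show False by fastforce
  qed (use M in auto)
  with M(1) that show thesis by blast
qed

section \<open>Vertices missed by a maximal linkage\<close>

text \<open>Inserting \<open>z\<close> between \<open>p1\<close> and \<open>p2\<close> would keep
  the number of members and cover more. At an end of the member, \<open>S\<close> or
  \<open>F\<close> stands for the arc from or to the missing neighbour.\<close>

lemma no_insertion:
  assumes max: "maximal_linkage W E S F \<L>" and p: "p1 @ p2 \<in> \<L>"
    and z: "chain E z" "z \<noteq> []" "distinct z" "set z \<subseteq> W - cover \<L>"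
    and front: "if p1 = [] then hd z \<in> S else (last p1, hd z) \<in> E"
    and rear: "if p2 = [] then last z \<in> F else (last z, hd p2) \<in> E"
  shows False
proof -
  have L: "linkage W E S F \<L>" using max by (simp add: maximal_linkage_def)
  then have p': "walk E S F (p1 @ p2)" "distinct (p1 @ p2)" "card \<L> > 0"
    using p unfolding linkage_def card_gt_0_iff by blast+
  have w: "walk E S F (p1 @ z @ p2)"
    using p'(1) z front rear
    by (auto simp: walk_def successively_append_iff hd_append last_append split: if_splits)
  have d: "distinct (p1 @ z @ p2)"
    using p'(2) z(3,4) p by fastforce
  have "set (p1 @ z @ p2) = cover {p1 @ p2} \<union> set z" by auto
  note r = linkage_replace[OF L _ w d this z(4)]
  have "card (insert (p1 @ z @ p2) (\<L> - {p1 @ p2})) = card \<L>"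
    using r(2) p p'(3) by simp
  moreover have "cover \<L> \<subset> cover \<L> \<union> set z"
    using hd_in_set[OF z(2)] z(4) by blast
  ultimately show False
    using max r(1,3) p unfolding maximal_linkage_def by (metis empty_subsetI insert_subset)
qed

text \<open>As \<open>w\<close> fits nowhere into the member, an arc into \<open>w\<close> from one
  vertex forces one from the next; membership of \<open>w\<close> in \<open>S\<close> starts this
  propagation at the first vertex.\<close>

lemma leftover_dominated:
  assumes max: "maximal_linkage W E S F \<L>" and semi: "semicomplete_on W E"
    and w: "w \<in> W - cover \<L>"
    and p: "p1 @ p2 \<in> \<L>"
    and front: "if p1 = [] then w \<in> S else (last p1, w) \<in> E"
  shows "\<forall>y\<in>set p2. (y, w) \<in> E"
  using p front
proof (induction p2 arbitrary: p1)
  case Nil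
  show ?case by simp
next
  case (Cons y p2)
  have "(w, y) \<notin> E"
    using no_insertion[OF max Cons.prems(1), of "[w]"] w Cons.prems(2) by (auto split: if_splits)
  moreover have "y \<in> W" "y \<noteq> w"
    using max w Cons.prems(1) unfolding maximal_linkage_def linkage_def by fastforce+
  ultimately have "(y, w) \<in> E" using semi w unfolding semicomplete_on_def by blast
  with Cons.IH[of "p1 @ [y]"] Cons.prems(1) show ?case by auto
qed

text \<open>Moves an arc into \<open>w\<close> to the end of the member, where a chain starting in
  \<open>w\<close> can be appended.\<close>

lemma leftover_last:
  assumes "maximal_linkage W E S F \<L>" "semicomplete_on W E"
    and "w \<in> W - cover \<L>" "p \<in> \<L>" "x \<in> set p" "(x, w) \<in> E"
  shows "(last p, w) \<in> E"
proof -
  obtain p1 p2 where p: "p = (p1 @ [x]) @ p2" using assms(5) by (auto dest: split_list)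
  then have "\<forall>y\<in>set p2. (y, w) \<in> E"
    using leftover_dominated[OF assms(1-3), of "p1 @ [x]" p2] assms(4,6) by simp
  with assms(6) show ?thesis
    unfolding p by (cases "p2 = []") auto
qed

lemma leftover_hd:
  assumes "maximal_linkage W E S F \<L>" "semicomplete_on W E"
    and "w \<in> W - cover \<L>" "p \<in> \<L>" "x \<in> set p" "(w, x) \<in> E"
  shows "(w, hd p) \<in> E"
  using leftover_last[OF maximal_linkage_converse[OF assms(1)], of w "rev p" x] assms(2-)
  by (auto simp: semicomplete_on_converse last_rev image_image)

text \<open>If \<open>w\<close> were in \<open>S\<close>, every covered vertex would dominate it. A
  path from \<open>w\<close> to \<open>F\<close> that avoids the cover could then be appended to any
  member; otherwise its part before the first covered vertex \<open>x\<close> could be inserted just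
  before \<open>x\<close>.\<close>

lemma leftover_not_source:
  assumes max: "maximal_linkage W E S F \<L>" and semi: "semicomplete_on W E" and "\<L> \<noteq> {}"
    and w: "w \<in> W - cover \<L>"
    and reach: "walk E {w} F c" "set c \<subseteq> W"
  shows "w \<notin> S"
proof
  assume "w \<in> S"
  then have dom: "(x, w) \<in> E" if "p \<in> \<L>" "x \<in> set p" for p x
    using leftover_dominated[OF max semi w, of "[]"] that by auto
  obtain d where d: "walk E {w} F d" "distinct d" "set d \<subseteq> set c"
    by (rule walk_distinct[OF reach(1)])
  with reach(2) have "set d \<subseteq> W" by blast
  show False
  proof (cases "set d \<inter> cover \<L> = {}")
    case True
    obtain p where p: "p \<in> \<L>" using \<open>\<L> \<noteq> {}\<close> by blast
    have "p \<noteq> []" using max p by (auto simp: maximal_linkage_def linkage_def walk_def)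
    with no_insertion[OF max, of p "[]" d] p d True dom[OF p, of "last p"] \<open>set d \<subseteq> W\<close> show False
      by (auto simp: walk_def)
  next
    case False
    then obtain d1 x d2 where x: "d = d1 @ x # d2" "x \<in> cover \<L>" "\<forall>y\<in>set d1. y \<notin> cover \<L>"
      using split_list_first_prop[of d "\<lambda>x. x \<in> cover \<L>"] by blast
    then obtain p where p: "p \<in> \<L>" "x \<in> set p" by blast
    then obtain p1 p2 where p12: "p = p1 @ x # p2" by (auto dest: split_list)
    have "d1 \<noteq> []" using x w d(1) by (auto simp: walk_def)
    moreover have "hd d1 = w" using x(1) d(1) \<open>d1 \<noteq> []\<close> by (auto simp: walk_def)
    moreover have "chain E d1" "(last d1, x) \<in> E"
      using x(1) d(1) \<open>d1 \<noteq> []\<close> by (auto simp: walk_def successively_append_iff)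
    moreover have "set d1 \<subseteq> W - cover \<L>" "distinct d1" using x d \<open>set d \<subseteq> W\<close> by auto
    moreover have "(last p1, w) \<in> E" if "p1 \<noteq> []"
      using dom[OF p(1), of "last p1"] that p12 by auto
    ultimately show False
      using no_insertion[OF max, of p1 "x # p2" d1] p p12 \<open>w \<in> S\<close>
      by (cases "p1 = []") auto
  qed
qed

lemma leftover_not_sink:
  assumes max: "maximal_linkage W E S F \<L>" and semi: "semicomplete_on W E" and "\<L> \<noteq> {}"
    and w: "w \<in> W - cover \<L>"
    and reach: "walk E S {w} c" "set c \<subseteq> W"
  shows "w \<notin> F"
  using leftover_not_source[OF maximal_linkage_converse[OF max], of w "rev c"] assms(2-)
  by (auto simp: semicomplete_on_converse image_image walk_rev)

text \<open>
  A generalisation of Camion's theorem: joining a new vertex \<open>x\<close> to \<open>R\<close> by arcs from \<open>x\<close>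
  to \<open>S\<close> and from \<open>F\<close> to \<open>x\<close> gives a strong semicomplete digraph, and a Hamiltonian cycle of it
  is a chain as in the conclusion.
\<close>

lemma hamiltonian_chain:
  assumes "finite R" "R \<noteq> {}" "semicomplete_on R E" "R \<subseteq> S \<union> F"
    and reaches: "\<And>r. r \<in> R \<Longrightarrow> \<exists>c. walk E {r} F c \<and> set c \<subseteq> R"
    and reached: "\<And>r. r \<in> R \<Longrightarrow> \<exists>c. walk E S {r} c \<and> set c \<subseteq> R"
  obtains z where "walk E S F z" "distinct z" "set z = R"
proof -
  obtain r where "r \<in> R" using assms(2) by blast
  then obtain c where c: "walk E S {r} c" "set c \<subseteq> R" using reached by blast
  then have "hd c \<in> R" "hd c \<in> S" by (auto simp: walk_def)
  with reaches obtain d where "walk E {hd c} F d" "set d \<subseteq> R" by blast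
  with \<open>hd c \<in> S\<close> have "walk E S F d" by (simp add: walk_def)
  then obtain q where "walk E S F q" "distinct q" "set q \<subseteq> set d"
    by (rule walk_distinct)
  with \<open>set d \<subseteq> R\<close> have "walk E S F q" "distinct q" "set q \<subseteq> R" by auto
  \<comment> \<open>For a maximal linkage with a single member, a missed vertex would lie outside
    both \<open>S\<close> and \<open>F\<close>, contrary to
    \<open>R \<subseteq> S \<union> F\<close>.\<close>
  then have "linkage R E S F {q}" by (auto simp: linkage_def)
  then obtain \<M> where M: "maximal_linkage R E S F \<M>" "card \<M> = 1"
    using maximal_linkage_exists[OF assms(1)] by (metis card_1_singleton_iff is_singletonI is_singleton_altdef)
  then obtain z where z: "\<M> = {z}" by (auto simp: card_1_singleton_iff)
  have "R - set z = {}"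
  proof (rule ccontr)
    assume "R - set z \<noteq> {}"
    then obtain w where w: "w \<in> R - cover \<M>" "w \<in> R" using z by auto
    have "w \<notin> S" "w \<notin> F"
      using reaches[OF w(2)] reached[OF w(2)] leftover_not_source[OF M(1) assms(3) _ w(1)]
        leftover_not_sink[OF M(1) assms(3) _ w(1)] z by blast+
    with w assms(4) show False by blast
  qed
  with M z that show thesis by (auto simp: maximal_linkage_def linkage_def)
qed

section \<open>Merging chains and reducing linkages\<close>

text \<open>As in merging sorted lists, the arc between the two heads decides which one comes
  first.\<close>

lemma merge_chains:
  assumes "chain E p" "chain E q" "p \<noteq> []" "q \<noteq> []" "distinct (p @ q)"
    and "semicomplete_on W E" "set p \<subseteq> W" "set q \<subseteq> W"
  shows "\<exists>z. chain E z \<and> z \<noteq> [] \<and> distinct z \<and> set z = set p \<union> set q \<and>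
    hd z \<in> {hd p, hd q} \<and> last z \<in> {last p, last q}"
  using assms
proof (induction "length p + length q" arbitrary: p q rule: less_induct)
  case less
  \<comment> \<open>Both candidates for the next vertex are out-neighbours of \<open>hd p\<close>:
    the second vertex of \<open>p\<close> by the chain, \<open>hd q\<close> by
    \<open>arc\<close>.\<close>
  have step: "\<exists>z. chain E z \<and> z \<noteq> [] \<and> distinct z \<and> set z = set p \<union> set q \<and>
      hd z \<in> {hd p, hd q} \<and> last z \<in> {last p, last q}"
    if arc: "(hd p, hd q) \<in> E" and
      IH: "tl p \<noteq> [] \<Longrightarrow> \<exists>z. chain E z \<and> z \<noteq> [] \<and> distinct z \<and> set z = set (tl p) \<union> set q \<and>
        hd z \<in> {hd (tl p), hd q} \<and> last z \<in> {last (tl p), last q}"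
      and pq: "chain E p" "chain E q" "p \<noteq> []" "q \<noteq> []" "distinct (p @ q)"
    for p q
  proof (cases "tl p = []")
    case True
    then obtain x where "p = [x]" using pq(3) by (cases p) auto
    with arc pq show ?thesis by (intro exI[of _ "x # q"]) (auto simp: successively_Cons)
  next
    case False
    then obtain z where z: "chain E z" "z \<noteq> []" "distinct z" "set z = set (tl p) \<union> set q"
        "hd z \<in> {hd (tl p), hd q}" "last z \<in> {last (tl p), last q}"
      using IH by blast
    obtain x p' where p': "p = x # p'" using pq(3) by (cases p) auto
    with z False arc pq show ?thesis
      by (intro exI[of _ "x # z"]) (auto simp: successively_Cons)
  qed
  have "hd p \<in> W" "hd q \<in> W" "hd p \<noteq> hd q"
    using less.prems by (auto simp: disjoint_iff) (metis hd_in_set)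
  then consider "(hd p, hd q) \<in> E" | "(hd q, hd p) \<in> E"
    using less.prems(6) unfolding semicomplete_on_def by blast
  then show ?case
  proof cases
    case 1
    obtain x p' where p': "p = x # p'" using less.prems(3) by (cases p) auto
    show ?thesis
      by (rule step[OF 1 less.hyps]) (use less.prems p' in \<open>auto simp: successively_Cons\<close>)
  next
    case 2
    obtain x q' where q': "q = x # q'" using less.prems(4) by (cases q) auto
    have "\<exists>z. chain E z \<and> z \<noteq> [] \<and> distinct z \<and> set z = set q \<union> set p \<and>
      hd z \<in> {hd q, hd p} \<and> last z \<in> {last q, last p}"
      by (rule step[OF 2 less.hyps]) (use less.prems q' in \<open>auto simp: successively_Cons\<close>)
    then show ?thesis by (simp add: Un_commute insert_commute)
  qed
qed

text \<open>Merging two members lowers the number by one and keeps the cover, as well as a start in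
  \<open>S\<close> and an end in \<open>F\<close>.\<close>

lemma linkage_decrease:
  assumes semi: "semicomplete_on W E" and "linkage W E S F \<L>" "1 \<le> k" "k \<le> card \<L>"
  obtains \<M> where "linkage W E S F \<M>" "card \<M> = k" "cover \<M> = cover \<L>"
proof -
  have "\<exists>\<M>. linkage W E S F \<M> \<and> card \<M> = k \<and> cover \<M> = cover \<L>"
    using assms(2,4)
  proof (induction "card \<L>" arbitrary: \<L>)
    case 0
    with assms(3) show ?case by simp
  next
    case (Suc n)
    show ?case
    proof (cases "k = Suc n")
      case True
      with Suc show ?thesis by auto
    next
      case False
      then have "2 \<le> card \<L>" using Suc assms(3) by linarith
      then obtain \<Q> where "\<Q> \<subseteq> \<L>" "card \<Q> = 2" by (meson obtain_subset_with_card_n)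
      then obtain p q where pq: "p \<in> \<L>" "q \<in> \<L>" "p \<noteq> q" by (auto simp: card_2_iff)
      have L: "walk E S F p" "distinct p" "set p \<subseteq> W" "walk E S F q" "distinct q" "set q \<subseteq> W"
          "set p \<inter> set q = {}"
        using Suc.prems(1) pq unfolding linkage_def by blast+
      then obtain z where z: "chain E z" "z \<noteq> []" "distinct z" "set z = set p \<union> set q"
          "hd z \<in> {hd p, hd q}" "last z \<in> {last p, last q}"
        using merge_chains[OF _ _ _ _ _ semi, of p q] by (auto simp: walk_def)
      have "walk E S F z" using z L by (auto simp: walk_def)
      note r = linkage_replace[OF Suc.prems(1) _ this z(3), of "{p, q}" "{}"]
      have "linkage W E S F (insert z (\<L> - {p, q}))" "card (insert z (\<L> - {p, q})) = n"
          "cover (insert z (\<L> - {p, q})) = cover \<L>"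
        using r pq z(4) Suc.hyps(2) \<open>2 \<le> card \<L>\<close> by auto
      then show ?thesis
        using Suc.hyps(1)[of "insert z (\<L> - {p, q})"] Suc.hyps(2) Suc.prems(2) False by auto
    qed
  qed
  with that show thesis by blast
qed

section \<open>Absorbing all uncovered vertices\<close>

text \<open>The surplus of two members pays for the surgery, which fuses at most three members into
  one.\<close>

theorem spanning_linkage:
  assumes fin: "finite W" and semi: "semicomplete_on W E"
    and L: "linkage W E S F \<L>" "k + 2 \<le> card \<L>" and k: "1 \<le> k"
    and reaches: "\<And>w. w \<in> W \<Longrightarrow> \<exists>c. walk E {w} F c \<and> set c \<subseteq> W"
    and reached: "\<And>w. w \<in> W \<Longrightarrow> \<exists>c. walk E S {w} c \<and> set c \<subseteq> W"
  obtains \<M> where "linkage W E S F \<M>" "card \<M> = k" "cover \<M> = W"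
proof -
  obtain \<N> where max: "maximal_linkage W E S F \<N>" and cN: "card \<N> = card \<L>"
    using maximal_linkage_exists[OF fin L(1)] .
  have N: "linkage W E S F \<N>" using max by (simp add: maximal_linkage_def)
  have "finite \<N>" "\<N> \<noteq> {}" using N cN L(2) by (auto simp: linkage_def)
  have mem: "walk E S F p" "distinct p" "set p \<subseteq> W" "p \<noteq> []" "hd p \<in> set p" "last p \<in> set p"
    if "p \<in> \<N>" for p
    using N that unfolding linkage_def walk_def by auto
  have disj: "set p \<inter> set q = {}" if "p \<in> \<N>" "q \<in> \<N>" "p \<noteq> q" for p q
    using N that unfolding linkage_def by blast
  have covW: "cover \<N> \<subseteq> W" using mem(3) by (simp add: UN_subset_iff)
  define R where "R = W - cover \<N>"
  have "\<exists>\<M>. linkage W E S F \<M> \<and> k \<le> card \<M> \<and> cover \<M> = W"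
  proof (cases "R = {}")
    case True
    with N cN L(2) covW show ?thesis unfolding R_def by (intro exI[of _ \<N>]) auto
  next
    case False
    have RW: "R \<subseteq> W" "R \<inter> cover \<N> = {}" by (auto simp: R_def)
    \<comment> \<open>\<open>S'\<close> and \<open>F'\<close> are the neighbourhoods of the vertex
      to which the cover is contracted.\<close>
    define S' where "S' = {r. \<exists>x\<in>cover \<N>. (x, r) \<in> E}"
    define F' where "F' = {r. \<exists>x\<in>cover \<N>. (r, x) \<in> E}"
    have toF': "\<exists>c. walk E {r} F' c \<and> set c \<subseteq> R" if r: "r \<in> R" for r
    proof -
      obtain c where c: "walk E {r} F c" "set c \<subseteq> W" using reaches r RW by blast
      then have "last c \<in> set c" "last c \<in> F" by (auto simp: walk_def)
      moreover have "last c \<in> W" using c(2) \<open>last c \<in> set c\<close> by blast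
      moreover obtain c' where "walk E S {last c} c'" "set c' \<subseteq> W"
        using reached[OF \<open>last c \<in> W\<close>] by blast
      \<comment> \<open>No uncovered vertex lies in \<open>F\<close>, so \<open>c\<close> must hit
        the cover; the part before the first hit lies in \<open>R\<close> and ends in
        \<open>F'\<close>.\<close>
      ultimately have "last c \<in> cover \<N>"
        using leftover_not_sink[OF max semi \<open>\<N> \<noteq> {}\<close>, of "last c" c'] by blast
      with \<open>last c \<in> set c\<close> have "\<exists>x\<in>set c. x \<in> cover \<N>" by blast
      then obtain c1 x c2 where x: "c = c1 @ x # c2" "x \<in> cover \<N>" "\<forall>y\<in>set c1. y \<notin> cover \<N>"
        using split_list_first_prop[of c "\<lambda>x. x \<in> cover \<N>"] by blast
      have "c1 \<noteq> []" using x c(1) r RW by (auto simp: walk_def)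
      then have "walk E {r} F' c1"
        using c(1) x(1,2) by (auto simp: walk_def F'_def successively_append_iff)
      moreover have "set c1 \<subseteq> R" using x c(2) by (auto simp: R_def)
      ultimately show ?thesis by blast
    qed
    have fromS': "\<exists>c. walk E S' {r} c \<and> set c \<subseteq> R" if r: "r \<in> R" for r
    proof -
      obtain c where c: "walk E S {r} c" "set c \<subseteq> W" using reached r RW by blast
      then have "hd c \<in> set c" "hd c \<in> S" by (auto simp: walk_def)
      moreover have "hd c \<in> W" using c(2) \<open>hd c \<in> set c\<close> by blast
      moreover obtain c' where "walk E {hd c} F c'" "set c' \<subseteq> W"
        using reaches[OF \<open>hd c \<in> W\<close>] by blast
      ultimately have "hd c \<in> cover \<N>"
        using leftover_not_source[OF max semi \<open>\<N> \<noteq> {}\<close>, of "hd c" c'] by blast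
      with \<open>hd c \<in> set c\<close> have "\<exists>x\<in>set c. x \<in> cover \<N>" by blast
      then obtain c1 x c2 where x: "c = c1 @ x # c2" "x \<in> cover \<N>" "\<forall>y\<in>set c2. y \<notin> cover \<N>"
        using split_list_last_prop[of c "\<lambda>x. x \<in> cover \<N>"] by blast
      have "c2 \<noteq> []" using x c(1) r RW by (auto simp: walk_def)
      then have "walk E S' {r} c2"
        using c(1) x(1,2) by (auto simp: walk_def S'_def successively_append_iff successively_Cons)
      moreover have "set c2 \<subseteq> R" using x c(2) by (auto simp: R_def)
      ultimately show ?thesis by blast
    qed
    obtain p0 where "p0 \<in> \<N>" using \<open>\<N> \<noteq> {}\<close> by blast
    then have "hd p0 \<in> cover \<N>" using mem(5)[of p0] by auto
    have "R \<subseteq> S' \<union> F'"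
    proof
      fix r assume "r \<in> R"
      then have "r \<in> W" "hd p0 \<in> W" "r \<noteq> hd p0" using \<open>hd p0 \<in> cover \<N>\<close> covW by (auto simp: R_def)
      with \<open>hd p0 \<in> cover \<N>\<close> semi show "r \<in> S' \<union> F'"
        unfolding semicomplete_on_def S'_def F'_def by blast
    qed
    moreover have "semicomplete_on R E" "finite R"
      using semi fin by (auto simp: semicomplete_on_def R_def)
    ultimately obtain z where z: "walk E S' F' z" "distinct z" "set z = R"
      using hamiltonian_chain[of R E S' F'] False toF' fromS' by blast
    have z': "z \<noteq> []" "chain E z" "hd z \<in> R" "last z \<in> R"
      using z by (auto simp: walk_def)
    have last: "(last p, w) \<in> E" if "p \<in> \<N>" "w \<in> R" "x \<in> set p" "(x, w) \<in> E" for p w x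
      using leftover_last[OF max semi _ that(1,3,4)] that(2) by (simp add: R_def)
    have hd: "(w, hd p) \<in> E" if "p \<in> \<N>" "w \<in> R" "x \<in> set p" "(w, x) \<in> E" for p w x
      using leftover_hd[OF max semi _ that(1,3,4)] that(2) by (simp add: R_def)
    have semi': "(x, w) \<in> E \<or> (w, x) \<in> E" if "p \<in> \<N>" "w \<in> R" "x \<in> set p" for p w x
    proof -
      have "x \<in> W" "w \<in> W" "x \<noteq> w" using that mem(3)[OF that(1)] by (auto simp: R_def)
      with semi show ?thesis by (auto simp: semicomplete_on_def)
    qed
    obtain p where p: "p \<in> \<N>" "(last p, hd z) \<in> E"
    proof -
      obtain x p where "p \<in> \<N>" "x \<in> set p" "(x, hd z) \<in> E"
        using z(1) by (auto simp: walk_def S'_def)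
      with last[of p "hd z" x] z'(3) that show thesis by simp
    qed
    obtain q where q: "q \<in> \<N>" "(last z, hd q) \<in> E"
    proof -
      obtain x q where "q \<in> \<N>" "x \<in> set q" "(last z, x) \<in> E"
        using z(1) by (auto simp: walk_def F'_def)
      with hd[of q "last z" x] z'(4) that show thesis by simp
    qed
    show ?thesis
    proof (cases "\<exists>p\<in>\<N>. \<exists>q\<in>\<N>. p \<noteq> q \<and> (last p, hd z) \<in> E \<and> (last z, hd q) \<in> E")
      case True
      then obtain p q where pq: "p \<in> \<N>" "q \<in> \<N>" "p \<noteq> q" "(last p, hd z) \<in> E" "(last z, hd q) \<in> E"
        by blast
      have w: "walk E S F (p @ z @ q)"
        using mem(1)[OF pq(1)] mem(1)[OF pq(2)] z'(1,2) pq(4,5)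
        by (auto simp: walk_def successively_append_iff)
      have d: "distinct (p @ z @ q)"
        using mem(2)[OF pq(1)] mem(2)[OF pq(2)] z(2,3) disj[OF pq(1-3)] pq(1,2) RW(2) by auto
      have "set (p @ z @ q) = cover {p, q} \<union> R" using z(3) by auto
      note r = linkage_replace[OF N _ w d this]
      have "linkage W E S F (insert (p @ z @ q) (\<N> - {p, q}))"
        "k \<le> card (insert (p @ z @ q) (\<N> - {p, q}))"
        "cover (insert (p @ z @ q) (\<N> - {p, q})) = W"
        using r pq(1-3) cN L(2) covW unfolding R_def by auto
      then show ?thesis by blast
    next
      case False
      then have join: "a = b" if "a \<in> \<N>" "b \<in> \<N>" "(last a, hd z) \<in> E" "(last z, hd b) \<in> E" for a b
        using that by blast
      have "p = q" using join[OF p(1) q(1) p(2) q(2)] .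
      define \<U> where "\<U> = \<N> - {p}"
      have U: "X \<in> \<N>" "X \<noteq> p" if "X \<in> \<U>" for X using that by (auto simp: \<U>_def)
      \<comment> \<open>Two members besides \<open>p\<close> are needed, because the cut of
        \<open>z\<close> below has to serve distinct \<open>X\<close> and \<open>Y\<close>.\<close>
      have "2 \<le> card \<U>" using p(1) \<open>finite \<N>\<close> cN L(2) k by (simp add: \<U>_def)
      then have other: "\<exists>Y\<in>\<U>. Y \<noteq> X" for X
        by (metis card_2_iff' card_le_Suc0_iff_eq card.infinite not_less_eq_eq numeral_2_eq_2 zero_le)
      \<comment> \<open>By \<open>join\<close>, \<open>hd z\<close> receives no arc from
        \<open>last X\<close> and \<open>last z\<close> sends none to \<open>hd X\<close>. An arc in
        the wrong direction elsewhere could be moved to these ends by \<open>last\<close> and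
        \<open>hd\<close>.\<close>
      have zU: "(hd z, hd X) \<in> E" "(last z, hd X) \<notin> E" "(last X, last z) \<in> E" if "X \<in> \<U>" for X
      proof -
        note X = U[OF that]
        have "(last X, hd z) \<notin> E" using join[OF X(1) q(1) _ q(2)] X(2) \<open>p = q\<close> by auto
        then show "(hd z, hd X) \<in> E"
          using semi'[OF X(1) z'(3), of "hd X"] last[OF X(1) z'(3), of "hd X"] mem(5)[OF X(1)] by auto
        show *: "(last z, hd X) \<notin> E" using join[OF p(1) X(1) p(2)] X(2) by auto
        show "(last X, last z) \<in> E"
          using semi'[OF X(1) z'(4), of "last X"] hd[OF X(1) z'(4), of "last X"] mem(6)[OF X(1)] * by auto
      qed
      \<comment> \<open>Otherwise \<open>(last z1, hd X) \<in> E\<close> would propagate along all prefixes \<open>z1\<close> of \<open>z\<close>, contradicting \<open>zU(2)\<close>.\<close>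
      have "\<exists>z1 z2 X Y. z = z1 @ z2 \<and> z1 \<noteq> [] \<and> z2 \<noteq> [] \<and> X \<in> \<U> \<and> Y \<in> \<U> \<and> X \<noteq> Y \<and>
          (last z1, hd X) \<in> E \<and> (last Y, hd z2) \<in> E"
      proof (rule ccontr)
        assume "\<not> ?thesis"
        then have no: "(last Y, hd z2) \<notin> E"
          if "z = z1 @ z2" "z1 \<noteq> []" "z2 \<noteq> []" "X \<in> \<U>" "Y \<in> \<U>" "X \<noteq> Y" "(last z1, hd X) \<in> E"
          for z1 z2 X Y
          using that by blast
        have "\<forall>X\<in>\<U>. (last z1, hd X) \<in> E" if "z = z1 @ z2" "z1 \<noteq> []" for z1 z2
          using that
        proof (induction z1 arbitrary: z2 rule: rev_induct)
          case Nil
          then show ?case by simp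
        next
          case (snoc a ys)
          show ?case
          proof (cases "ys = []")
            case True
            with snoc.prems zU(1) show ?thesis by auto
          next
            case ys: False
            show ?thesis
            proof
              fix Y assume Y: "Y \<in> \<U>"
              \<comment> \<open>With this \<open>X\<close> the cut before \<open>a\<close> is
                excluded, so \<open>a\<close> has an arc to \<open>last Y\<close>, which
                \<open>hd\<close> moves to \<open>hd Y\<close>.\<close>
              obtain X where X: "X \<in> \<U>" "X \<noteq> Y" using other by blast
              have "(last ys, hd X) \<in> E" using snoc.IH[of "a # z2"] snoc.prems ys X by auto
              then have "(last Y, a) \<notin> E"
                using no[of ys "a # z2" X Y] X Y snoc.prems(1) ys by simp
              moreover have "a \<in> R" using snoc.prems z(3) by auto
              ultimately show "(last (ys @ [a]), hd Y) \<in> E"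
                using semi'[OF U(1)[OF Y], of a "last Y"] hd[OF U(1)[OF Y], of a "last Y"]
                  mem(6)[OF U(1)[OF Y]] by auto
            qed
          qed
        qed
        from this[of z "[]"] z'(1) have "\<forall>X\<in>\<U>. (last z, hd X) \<in> E" by simp
        moreover obtain X where "X \<in> \<U>" using other by blast
        ultimately show False using zU(2) by blast
      qed
      then obtain z1 z2 X Y where zz: "z = z1 @ z2" "z1 \<noteq> []" "z2 \<noteq> []"
          and XY: "X \<in> \<U>" "Y \<in> \<U>" "X \<noteq> Y" "(last z1, hd X) \<in> E" "(last Y, hd z2) \<in> E"
        by blast
      note X = U[OF XY(1)] and Y = U[OF XY(2)]
      \<comment> \<open>The arcs from \<open>last p\<close> to \<open>hd z\<close> and from
        \<open>last z\<close> to \<open>hd p\<close> let \<open>p\<close> stand between the two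
        pieces of \<open>z\<close> in swapped order.\<close>
      let ?n = "Y @ z2 @ p @ z1 @ X"
      have w: "walk E S F ?n"
        using mem(1)[OF X(1)] mem(1)[OF Y(1)] mem(1)[OF p(1)] z'(2) zz XY(4,5) p(2) q(2) \<open>p = q\<close>
        by (auto simp: walk_def successively_append_iff)
      have "set p \<inter> R = {}" "set X \<inter> R = {}" "set Y \<inter> R = {}"
        using p(1) X(1) Y(1) RW(2) by blast+
      then have d: "distinct ?n"
        using mem(2)[OF X(1)] mem(2)[OF Y(1)] mem(2)[OF p(1)] z(2,3) zz(1)
          disj[OF X(1) Y(1) XY(3)] disj[OF X(1) p(1) X(2)] disj[OF Y(1) p(1) Y(2)]
        by auto
      have "set ?n = cover {p, X, Y} \<union> R" using z(3) zz(1) by auto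
      note r = linkage_replace[OF N _ w d this]
      have "card {p, X, Y} = 3" using X(2) Y(2) XY(3) by auto
      then have "linkage W E S F (insert ?n (\<N> - {p, X, Y}))"
        "k \<le> card (insert ?n (\<N> - {p, X, Y}))"
        "cover (insert ?n (\<N> - {p, X, Y})) = W"
        using r p(1) X(1) Y(1) cN L(2) covW unfolding R_def by auto
      then show ?thesis by blast
    qed
  qed
  then obtain \<M> where "linkage W E S F \<M>" "k \<le> card \<M>" "cover \<M> = W" by blast
  with linkage_decrease[OF semi _ k] that show thesis by metis
qed

subsection \<open>Tournaments\<close>

lemma is_path_iff:
  "is_path A P u v \<longleftrightarrow> P \<noteq> [] \<and> hd P = u \<and> last P = v \<and> distinct P \<and> chain A P"
  unfolding is_path_def successively_conv_nth by simp

text \<open>Containers allow either direction of the paths; this justifies fixing the direction of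
  the arc between \<open>u\<close> and \<open>v\<close>.\<close>

lemma strong_container_commute: "strong_container k V A u v \<longleftrightarrow> strong_container k V A v u"
proof -
  have "internally_disjoint Ps u v \<longleftrightarrow> internally_disjoint Ps v u" for Ps
    unfolding internally_disjoint_def insert_commute[of u] ..
  then show ?thesis unfolding strong_container_def by blast
qed

lemma m_strong_walk:
  assumes "m_strong m V A" "X \<subseteq> V" "card X < m" "x \<in> V - X" "y \<in> V - X"
  obtains P where "is_path A P x y" "set P \<subseteq> V - X"
proof -
  let ?A = "induced_arcs (induced_arcs A (V - X)) (V - X)"
  obtain P where P: "is_path ?A P x y"
    using assms unfolding m_strong_def strongly_connected_def by blast
  have "chain ?A p \<Longrightarrow> hd p \<in> V - X \<Longrightarrow> chain A p \<and> set p \<subseteq> V - X" for p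
    by (induction p rule: induct_list012) (auto simp: induced_arcs_def)
  with P assms(4) that show thesis unfolding is_path_iff by metis
qed

text \<open>Each interior \<open>p\<close> becomes the path \<open>u # p @ [v]\<close>;
  \<open>1 \<le> k\<close> ensures that \<open>u\<close> and \<open>v\<close> are covered
  too.\<close>

lemma strong_container_linkage:
  assumes "linkage (V - {u, v}) A S F \<L>" "card \<L> = k" "cover \<L> = V - {u, v}" "1 \<le> k"
    and "u \<in> V" "v \<in> V" "u \<noteq> v" "S \<subseteq> {w. (u, w) \<in> A}" "F \<subseteq> {w. (w, v) \<in> A}"
  shows "strong_container k V A u v"
proof -
  obtain L where L: "set L = \<L>" "distinct L"
    using finite_distinct_list[of \<L>] assms(1) by (auto simp: linkage_def)
  let ?Ps = "map (\<lambda>p. u # p @ [v]) L"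
  have "length ?Ps = k" using L assms(2) distinct_card by fastforce
  moreover have "internally_disjoint ?Ps u v"
    unfolding internally_disjoint_def
  proof (intro conjI allI impI)
    show "distinct ?Ps" using L(2) by (auto simp: distinct_map inj_on_def)
    fix i j assume "i < length ?Ps" "j < length ?Ps" "i \<noteq> j"
    then have ij: "i < length L" "j < length L" "L ! i \<noteq> L ! j"
      using L(2) nth_eq_iff_index_eq by auto
    then have "set (L ! i) \<inter> set (L ! j) = {}"
      using assms(1) L(1) nth_mem[of i L] nth_mem[of j L] by (simp add: linkage_def)
    with ij show "set (?Ps ! i) \<inter> set (?Ps ! j) \<subseteq> {u, v}" by auto
  qed
  moreover have "\<forall>P\<in>set ?Ps. is_path A P u v"
  proof
    fix P assume "P \<in> set ?Ps"
    then obtain p where p: "P = u # p @ [v]" "p \<in> \<L>" using L by auto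
    then have "walk A S F p" "distinct p" "set p \<subseteq> V - {u, v}"
      using assms(1) by (auto simp: linkage_def)
    with p(1) assms(7-9) show "is_path A P u v"
      by (auto simp: is_path_iff walk_def successively_append_iff successively_Cons)
  qed
  moreover have "(\<Union>P\<in>set ?Ps. set P) = V"
  proof -
    have "\<L> \<noteq> {}" using assms(2,4) by auto
    then have "(\<Union>P\<in>set ?Ps. set P) = insert u (insert v (cover \<L>))" using L by auto
    with assms(3,5,6) show ?thesis by auto
  qed
  ultimately show ?thesis unfolding strong_container_def by blast
qed

text \<open>The arc \<open>(v, u)\<close> excludes \<open>(u, v)\<close>, so no path from
  \<open>u\<close> to \<open>v\<close> has an empty interior. \<open>k \<ge> 2\<close> gives
  \<open>k + 2 \<le> 2 * k\<close>, hence the two extra paths for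
  \<open>spanning_linkage\<close>.\<close>

lemma strong_container_of_back_arc:
  assumes k: "k \<ge> 2" and T: "tournament V A" and strong: "m_strong (2 * k) V A"
    and uv: "u \<in> V" "v \<in> V" "u \<noteq> v" "(v, u) \<in> A"
  shows "strong_container k V A u v"
proof -
  have nuv: "(u, v) \<notin> A" using T uv unfolding tournament_def by blast
  have fin: "finite V" using T by (simp add: tournament_def digraph_def)
  define W where "W = V - {u, v}"
  define S where "S = {w \<in> W. (u, w) \<in> A}"
  define F where "F = {w \<in> W. (w, v) \<in> A}"
  have finW: "finite W" using fin by (simp add: W_def)
  have semi: "semicomplete_on W A"
    using T unfolding semicomplete_on_def tournament_def W_def by blast
  have reaches: "\<exists>c. walk A {w} F c \<and> set c \<subseteq> W" if w: "w \<in> W" for w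
  proof -
    \<comment> \<open>Deleting \<open>u\<close> alone keeps the digraph strong; dropping the final
      \<open>v\<close> leaves a walk to \<open>F\<close> inside \<open>W\<close>.\<close>
    obtain P where P: "is_path A P w v" "set P \<subseteq> V - {u}"
      by (rule m_strong_walk[OF strong, of "{u}" w v]) (use w uv k in \<open>auto simp: W_def\<close>)
    then obtain c where c: "P = c @ [v]" by (metis append_butlast_last_id is_path_iff)
    then have "c \<noteq> []" using P(1) w by (auto simp: is_path_iff W_def)
    moreover have "set c \<subseteq> W" using P c by (auto simp: is_path_iff W_def)
    moreover have "last c \<in> W" using calculation by auto
    ultimately show ?thesis using P(1) c
      by (intro exI[of _ c]) (auto simp: is_path_iff walk_def F_def successively_append_iff)
  qed
  have reached: "\<exists>c. walk A S {w} c \<and> set c \<subseteq> W" if w: "w \<in> W" for w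
  proof -
    obtain P where P: "is_path A P u w" "set P \<subseteq> V - {v}"
      by (rule m_strong_walk[OF strong, of "{v}" u w]) (use w uv k in \<open>auto simp: W_def\<close>)
    then obtain c where c: "P = u # c" by (metis list.collapse is_path_iff)
    then have "c \<noteq> []" using P(1) w by (auto simp: is_path_iff W_def)
    moreover have "set c \<subseteq> W" using P c by (auto simp: is_path_iff W_def)
    moreover have "hd c \<in> W" using calculation by auto
    ultimately show ?thesis using P(1) c
      by (intro exI[of _ c]) (auto simp: is_path_iff walk_def S_def successively_Cons)
  qed
  \<comment> \<open>Restricting the arcs keeps the walks of Menger's theorem away from
    \<open>u\<close> and \<open>v\<close>.\<close>
  let ?E = "A \<inter> W \<times> W"
  have chainE: "chain ?E p \<longleftrightarrow> chain A p" if "set p \<subseteq> W" for p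
    using that by (induction p rule: induct_list012) auto
  have "k + 2 \<le> card X" if X: "finite X" "separates ?E S F X" for X
  proof (rule ccontr)
    assume "\<not> k + 2 \<le> card X"
    moreover have "card (X \<inter> W) \<le> card X" using X(1) by (intro card_mono) auto
    ultimately have "card (X \<inter> W) < 2 * k" using k by linarith
    \<comment> \<open>A separator this small can be deleted without destroying strong connectivity;
      the interior of the surviving path is a walk that avoids it.\<close>
    then obtain P where P: "is_path A P u v" "set P \<subseteq> V - X \<inter> W"
      by (rule_tac m_strong_walk[OF strong, of "X \<inter> W" u v]) (use uv in \<open>auto simp: W_def\<close>)
    obtain P' where P': "P = u # P'" using P(1) by (metis list.collapse is_path_iff)
    with P(1) uv(3) have "P' \<noteq> []" by (auto simp: is_path_iff)
    then obtain c where c: "P = u # c @ [v]"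
      using P(1) P' by (metis append_butlast_last_id is_path_iff last_ConsR)
    have "c \<noteq> []" using P(1) c nuv by (auto simp: is_path_iff)
    moreover have cW: "set c \<subseteq> W" "set c \<inter> X = {}" using P c by (auto simp: is_path_iff W_def)
    moreover have "hd c \<in> W" "last c \<in> W" using calculation by auto
    ultimately have "walk ?E S F c"
      using P(1) c chainE[OF cW(1)]
      by (auto simp: is_path_iff walk_def S_def F_def successively_Cons successively_append_iff)
    with X(2) cW(2) show False by (auto simp: separates_def)
  qed
  then obtain P where P: "\<forall>i<k+2. walk ?E S F (P i) \<and> distinct (P i)"
      "\<forall>i<k+2. \<forall>j<k+2. i \<noteq> j \<longrightarrow> set (P i) \<inter> set (P j) = {}"
    using menger[of ?E S F "k + 2"] finW by (auto simp: S_def)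
  have sub: "set p \<subseteq> W" if "walk ?E S F p" for p
  proof -
    have "chain ?E p \<Longrightarrow> hd p \<in> W \<Longrightarrow> set p \<subseteq> W"
      by (induction p rule: induct_list012) auto
    with that show ?thesis by (auto simp: walk_def S_def)
  qed
  have link: "linkage W A S F (P ` {..<k+2})"
    unfolding linkage_def
  proof (intro conjI ballI impI)
    fix p assume "p \<in> P ` {..<k+2}"
    then have "walk ?E S F p" "distinct p" using P(1) by auto
    with sub[of p] chainE[of p] show "walk A S F p" "distinct p" "set p \<subseteq> W"
      by (auto simp: walk_def)
  qed (use P(2) in auto)
  have "inj_on P {..<k+2}"
  proof (rule inj_onI, rule ccontr)
    fix i j assume "i \<in> {..<k+2}" "j \<in> {..<k+2}" "P i = P j" "i \<noteq> j"
    with P show False unfolding walk_def by (metis Int_absorb lessThan_iff set_empty)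
  qed
  then have "card (P ` {..<k+2}) = k + 2" by (simp add: card_image)
  then obtain \<M> where "linkage W A S F \<M>" "card \<M> = k" "cover \<M> = W"
    using spanning_linkage[OF finW semi link, of k] reaches reached k by auto
  then show ?thesis
    using strong_container_linkage[of V u v A S F \<M> k] uv k
    by (auto simp: W_def S_def F_def)
qed

theorem theorem3p1:
  fixes k :: nat and V :: "'a set" and A :: "('a \<times> 'a) set"
  assumes "k \<ge> 2" and "tournament V A" and "m_strong (2 * k) V A"
  shows "k_star_strongly_connected k V A"
  unfolding k_star_strongly_connected_def
proof (intro ballI impI)
  fix u v assume uv: "u \<in> V" "v \<in> V" "u \<noteq> v"
  then consider "(v, u) \<in> A" | "(u, v) \<in> A"
    using assms(2) unfolding tournament_def by blast
  then show "strong_container k V A u v"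
    using strong_container_of_back_arc[OF assms] strong_container_commute uv by metis
qed

end
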